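(* Let $X$ be a topological space, $Y$ a Hausdorff topological space, and $f:X\to Y$ a function. Consider the condition: ( * ) for each point $x\in X$ there is a subset $K_x\subset Y$ such that for each neighborhood $O_{f(x)}\subset Y$ of $f(x)$ there is a neighborhood $O_x\subset X$ of $x$ such that $f(O_x)\subset O_{f(x)}\cup K_x$ and the set $K_x\setminus O_{f(x)}$ is finite. If ( * ) holds, then $f$ is compact-preserving. If the space $X$ is strong Fréchet, then $f$ is compact-preserving if and only if ( * ) holds.
   Context: A function $f:X\to Y$ between topological spaces (not assumed continuous) is compact-preserving if the image $f(K)$ of each compact subset $K\subset X$ is compact. Compact means that every open cover has a finite subcover (no separation axiom included). A topological space $X$ is strong Fréchet if for any decreasing sequence $(A_n)_{n\in\omega}$ of subsets of $X$ and any point $a\in\bigcap_{n\in\omega}\bar A_n$ there is a sequence of points $a_n\in A_n$, $n\in\omega$, that converges to $a$. *)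

theory Defs
  imports "HOL-Analysis.Analysis"
begin

text \<open>
  Spaces are values of the type of abstract topologies, so no separation axiom is built in and the
  underlying set is \<^const>\<open>topspace\<close>. Neighbourhoods are not required to be open.
\<close>

definition neighbourhood_in :: "'a topology \<Rightarrow> 'a \<Rightarrow> 'a set \<Rightarrow> bool" where
  "neighbourhood_in X x N \<longleftrightarrow> N \<subseteq> topspace X \<and> (\<exists>U. openin X U \<and> x \<in> U \<and> U \<subseteq> N)"

definition compact_preserving_map :: "'a topology \<Rightarrow> 'b topology \<Rightarrow> ('a \<Rightarrow> 'b) \<Rightarrow> bool" where
  "compact_preserving_map X Y f \<longleftrightarrow>
     f \<in> topspace X \<rightarrow> topspace Y \<and> (\<forall>K. compactin X K \<longrightarrow> compactin Y (f ` K))"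

definition strong_Frechet_space :: "'a topology \<Rightarrow> bool" where
  "strong_Frechet_space X \<longleftrightarrow>
     (\<forall>(A :: nat \<Rightarrow> 'a set) a.
        (\<forall>n. A n \<subseteq> topspace X) \<and> decseq A \<and> a \<in> (\<Inter>n. X closure_of A n) \<longrightarrow>
        (\<exists>s. (\<forall>n. s n \<in> A n) \<and> limitin X s a sequentially))"

text \<open>
  The set \<open>K\<close> depends on the point \<open>x\<close> only, not on the neighbourhood \<open>V\<close> of \<open>f x\<close>.
\<close>

definition finite_exception_condition :: "'a topology \<Rightarrow> 'b topology \<Rightarrow> ('a \<Rightarrow> 'b) \<Rightarrow> bool" where
  "finite_exception_condition X Y f \<longleftrightarrow>
     (\<forall>x \<in> topspace X. \<exists>K. K \<subseteq> topspace Y \<and>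
        (\<forall>V. neighbourhood_in Y (f x) V \<longrightarrow>
           (\<exists>U. neighbourhood_in X x U \<and> f ` U \<subseteq> V \<union> K \<and> finite (K - V))))"

end

theory Submission
  imports Defs
begin

text \<open>
  If \<open>s\<^sub>n \<rightarrow> x\<close> and \<open>f\<close> is compact-preserving, then only finitely many values \<open>f s\<^sub>n\<close> lie outside an
  open neighbourhood \<open>V\<close> of \<open>f x\<close>: every subset of the set of these values is the image of a compact
  set minus \<open>V\<close>, hence compact, hence closed, so the set is compact and discrete. For the necessity
  of the condition take as \<open>K\<^sub>x\<close> the set of all values \<open>z\<close> whose fibre has \<open>x\<close> in its closure.
  Infinitely many values of \<open>K\<^sub>x\<close> outside \<open>V\<close> would yield, by the strong Frechet property, a sequence
  converging to \<open>x\<close> with infinitely many values outside \<open>V\<close>; and if \<open>x\<close> is in the closure of the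
  preimage of the complement of \<open>V \<union> K\<^sub>x\<close>, then a sequence in that preimage converging to \<open>x\<close> takes
  one of its values infinitely often, so this value lies in \<open>K\<^sub>x\<close>.
\<close>

lemma finite_exception_imp_compact_preserving:
  assumes f: "f \<in> topspace X \<rightarrow> topspace Y" and cond: "finite_exception_condition X Y f"
  shows "compact_preserving_map X Y f"
  unfolding compact_preserving_map_def
proof (intro conjI allI impI f)
  fix C assume C: "compactin X C"
  then have CX: "C \<subseteq> topspace X"
    by (rule compactin_subset_topspace)
  show "compactin Y (f ` C)"
    unfolding compactin_def
  proof (intro conjI allI impI)
    show "f ` C \<subseteq> topspace Y"
      using CX f by auto
    fix \<U> assume \<U>: "(\<forall>U\<in>\<U>. openin Y U) \<and> f ` C \<subseteq> \<Union>\<U>"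
    have "\<exists>V U. V \<in> \<U> \<and> openin X U \<and> x \<in> U \<and> finite (f ` U - V)" if x: "x \<in> C" for x
    proof -
      obtain V where V: "V \<in> \<U>" "f x \<in> V" "openin Y V"
        using x \<U> by blast
      then have "neighbourhood_in Y (f x) V"
        unfolding neighbourhood_in_def using openin_subset by blast
      then obtain K U where U: "neighbourhood_in X x U" "f ` U \<subseteq> V \<union> K" "finite (K - V)"
        using cond x CX unfolding finite_exception_condition_def by blast
      then obtain W where W: "openin X W" "x \<in> W" "W \<subseteq> U"
        unfolding neighbourhood_in_def by blast
      have "f ` W - V \<subseteq> K - V"
        using U(2) W(3) by blast
      then show ?thesis
        using U(3) V(1) W(1,2) finite_subset by blast
    qed
    then obtain V U where VU:
      "\<And>x. x \<in> C \<Longrightarrow> V x \<in> \<U> \<and> openin X (U x) \<and> x \<in> U x \<and> finite (f ` U x - V x)"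
      by metis
    have "(\<forall>W\<in>U ` C. openin X W) \<and> C \<subseteq> \<Union>(U ` C)"
      using VU by blast
    then obtain \<F> where "finite \<F>" "\<F> \<subseteq> U ` C" "C \<subseteq> \<Union>\<F>"
      using C unfolding compactin_def by meson
    then obtain D where D: "finite D" "D \<subseteq> C" "C \<subseteq> \<Union>(U ` D)"
      by (metis finite_subset_image)
    define E where "E = (\<Union>x\<in>D. f ` U x - V x) \<inter> f ` C"
    have "finite E"
      unfolding E_def using D VU by blast
    moreover have "\<forall>z\<in>E. \<exists>W\<in>\<U>. z \<in> W"
      unfolding E_def using \<U> by blast
    then obtain g where g: "\<And>z. z \<in> E \<Longrightarrow> g z \<in> \<U> \<and> z \<in> g z"
      by metis
    have "f ` C \<subseteq> \<Union>(V ` D \<union> g ` E)"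
    proof
      fix z assume z: "z \<in> f ` C"
      then obtain x where x: "x \<in> D" "z \<in> f ` U x"
        using D(3) by blast
      show "z \<in> \<Union>(V ` D \<union> g ` E)"
      proof (cases "z \<in> V x")
        case False
        then have "z \<in> E"
          unfolding E_def using x z by blast
        then show ?thesis
          using g by blast
      qed (use x in blast)
    qed
    moreover have "V ` D \<union> g ` E \<subseteq> \<U>"
      using VU D(2) g by blast
    ultimately show "\<exists>\<F>. finite \<F> \<and> \<F> \<subseteq> \<U> \<and> f ` C \<subseteq> \<Union>\<F>"
      using D(1) by (metis finite_UnI finite_imageI)
  qed
qed

text \<open>A member of the cover around \<open>x\<close> contains all but finitely many terms. The
  index set \<open>I\<close> is arbitrary, possibly finite, so that terms can be selected by their
  values without passing to a subsequence.\<close>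

lemma compactin_insert_limit:
  assumes lim: "limitin X s x sequentially" and s: "\<And>n::nat. s n \<in> topspace X"
  shows "compactin X (insert x (s ` I))"
  unfolding compactin_def
proof (intro conjI allI impI)
  show "insert x (s ` I) \<subseteq> topspace X"
    using s limitin_topspace[OF lim] by auto
  fix \<U> assume \<U>: "(\<forall>U\<in>\<U>. openin X U) \<and> insert x (s ` I) \<subseteq> \<Union>\<U>"
  then obtain U where U: "U \<in> \<U>" "x \<in> U" "openin X U"
    by blast
  then obtain N where N: "\<And>n. n \<ge> N \<Longrightarrow> s n \<in> U"
    using lim unfolding limitin_sequentially by blast
  have "\<forall>n\<in>I. \<exists>W\<in>\<U>. s n \<in> W"
    using \<U> by blast
  then obtain g where g: "\<And>n. n \<in> I \<Longrightarrow> g n \<in> \<U> \<and> s n \<in> g n"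
    by metis
  have "insert x (s ` I) \<subseteq> \<Union>(insert U (g ` (I \<inter> {..<N})))"
  proof
    fix y assume "y \<in> insert x (s ` I)"
    then consider "y = x" | n where "n \<in> I" "y = s n"
      by blast
    then show "y \<in> \<Union>(insert U (g ` (I \<inter> {..<N})))"
    proof cases
      case 2
      show ?thesis
      proof (cases "n < N")
        case True
        then show ?thesis
          using 2 g by blast
      qed (use 2 N in auto)
    qed (use U(2) in blast)
  qed
  moreover have "insert U (g ` (I \<inter> {..<N})) \<subseteq> \<U>"
    using U(1) g by blast
  ultimately show "\<exists>\<F>. finite \<F> \<and> \<F> \<subseteq> \<U> \<and> insert x (s ` I) \<subseteq> \<Union>\<F>"
    by (meson finite_Int finite_imageI finite_insert finite_lessThan)
qed

text \<open>If \<open>S\<close> is infinite, its compactness gives an accumulation point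
  \<open>p\<close> of \<open>S\<close> in \<open>S\<close>. But \<open>S - {p}\<close> is compact,
  hence closed in a Hausdorff space, and its complement is a neighbourhood of \<open>p\<close> that
  meets \<open>S\<close> only in \<open>p\<close>.\<close>

lemma finite_if_all_subsets_compactin:
  assumes "Hausdorff_space Y" and sub: "\<And>T. T \<subseteq> S \<Longrightarrow> compactin Y T"
  shows "finite S"
proof (rule ccontr)
  assume "infinite S"
  then have "S \<inter> Y derived_set_of S \<noteq> {}"
    using sub[of S] compactin_imp_Bolzano_Weierstrass[of Y S S] by blast
  then obtain p where p: "p \<in> S" "p \<in> Y derived_set_of S"
    by blast
  have "closedin Y (S - {p})"
    using assms by (meson Diff_subset compactin_imp_closedin)
  then have "openin Y (topspace Y - (S - {p}))"
    by (simp add: openin_diff)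
  moreover have "p \<in> topspace Y - (S - {p})"
    using p by (simp add: in_derived_set_of)
  ultimately obtain q where "q \<noteq> p" "q \<in> S" "q \<in> topspace Y - (S - {p})"
    using p(2) unfolding in_derived_set_of by metis
  then show False
    by simp
qed

lemma compact_preserving_sequence:
  assumes Y: "Hausdorff_space Y" and f: "compact_preserving_map X Y f"
    and lim: "limitin X s x sequentially" and s: "\<And>n::nat. s n \<in> topspace X"
    and V: "openin Y V" "f x \<in> V"
  shows "finite (f ` range s - V)"
proof (rule finite_if_all_subsets_compactin[OF Y])
  fix T assume T: "T \<subseteq> f ` range s - V"
  \<comment> \<open>Keeping only the terms with value in \<open>T\<close> gives the image
    \<open>T\<close> together with \<open>f x\<close>; as \<open>T\<close> misses \<open>V\<close>,
    removing \<open>V\<close> deletes exactly \<open>f x\<close>.\<close>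
  let ?C = "insert x (s ` {n. f (s n) \<in> T})"
  have "compactin Y (f ` ?C)"
    using f compactin_insert_limit[OF lim s] unfolding compact_preserving_map_def by blast
  then have "compactin Y ((topspace Y - V) \<inter> f ` ?C)"
    using V(1) by (intro closed_Int_compactin) auto
  moreover have "f ` ?C \<subseteq> topspace Y"
    using \<open>compactin Y (f ` ?C)\<close> compactin_subset_topspace by blast
  then have "(topspace Y - V) \<inter> f ` ?C = T"
    using T V(2) by auto
  ultimately show "compactin Y T"
    by simp
qed

lemma compact_preserving_imp_finite_exception:
  fixes X :: "'a topology" and Y :: "'b topology" and f :: "'a \<Rightarrow> 'b"
  assumes Y: "Hausdorff_space Y" and X: "strong_Frechet_space X"
    and f: "compact_preserving_map X Y f"
  shows "finite_exception_condition X Y f"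
  unfolding finite_exception_condition_def
proof
  fix x assume x: "x \<in> topspace X"
  have fXY: "f \<in> topspace X \<rightarrow> topspace Y"
    using f unfolding compact_preserving_map_def by blast
  define K where "K = {z \<in> topspace Y. x \<in> X closure_of {p \<in> topspace X. f p = z}}"
  show "\<exists>K. K \<subseteq> topspace Y \<and> (\<forall>V. neighbourhood_in Y (f x) V \<longrightarrow>
           (\<exists>U. neighbourhood_in X x U \<and> f ` U \<subseteq> V \<union> K \<and> finite (K - V)))"
  proof (intro exI[of _ K] conjI allI impI)
    show "K \<subseteq> topspace Y"
      unfolding K_def by blast
    fix N assume "neighbourhood_in Y (f x) N"
    then obtain V where V: "openin Y V" "f x \<in> V" "V \<subseteq> N"
      unfolding neighbourhood_in_def by blast
    have Kfin: "finite (K - V)"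
    proof (rule ccontr)
      assume "infinite (K - V)"
      then obtain z :: "nat \<Rightarrow> 'b" where z: "inj z" "range z \<subseteq> K - V"
        using infinite_countable_subset by blast
      \<comment> \<open>Using the fibres over a whole tail of \<open>z\<close> makes the sets
        decrease, while each still has \<open>x\<close> in its closure. A selection from them must
        take values \<open>z m\<close> with arbitrarily large \<open>m\<close>.\<close>
      define A where "A n = {p \<in> topspace X. f p \<in> z ` {n..}}" for n
      have "decseq A"
        unfolding A_def decseq_def by fastforce
      moreover have "x \<in> X closure_of A n" for n
      proof -
        have "x \<in> X closure_of {p \<in> topspace X. f p = z n}"
          using z(2) unfolding K_def by blast
        moreover have "{p \<in> topspace X. f p = z n} \<subseteq> A n"
          unfolding A_def by auto
        ultimately show ?thesis
          using closure_of_mono by blast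
      qed
      moreover have "A n \<subseteq> topspace X" for n
        unfolding A_def by blast
      ultimately obtain s where s: "\<And>n. s n \<in> A n" "limitin X s x sequentially"
        using X unfolding strong_Frechet_space_def by (metis INT_I)
      have "finite (f ` range s - V)"
        using s V by (intro compact_preserving_sequence[OF Y f s(2)]) (auto simp: A_def)
      then have "finite (z -` (f ` range s - V))"
        using z(1) by (rule finite_vimageI)
      \<comment> \<open>\<open>M\<close> exceeds every index \<open>m\<close> for which
        \<open>z m\<close> is a value along \<open>s\<close>, yet the value at \<open>s M\<close> is
        some \<open>z m\<close> with \<open>m \<ge> M\<close>.\<close>
      then obtain M where M: "\<And>m. m \<in> z -` (f ` range s - V) \<Longrightarrow> m < M"
        unfolding finite_nat_set_iff_bounded by metis
      obtain m where m: "m \<ge> M" "f (s M) = z m"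
        using s(1)[of M] unfolding A_def by auto
      have "f (s M) \<in> f ` range s - V"
        using m(2) z(2) by (metis DiffE DiffI imageI rangeI subsetD)
      then have "m < M"
        using M m(2) by simp
      then show False
        using m(1) by simp
    qed
    define B where "B = {p \<in> topspace X. f p \<notin> V \<union> K}"
    have "x \<notin> X closure_of B"
    proof
      assume "x \<in> X closure_of B"
      \<comment> \<open>For a constant sequence of sets the strong Frechet property gives the plain
        one: a point in the closure of \<open>B\<close> is the limit of a sequence in
        \<open>B\<close>.\<close>
      moreover have "decseq (\<lambda>_::nat. B)"
        by (simp add: decseq_def)
      moreover have "B \<subseteq> topspace X"
        unfolding B_def by blast
      ultimately obtain s where s: "\<And>n. s n \<in> B" "limitin X s x sequentially"
        using X unfolding strong_Frechet_space_def by (metis INT_I)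
      have "finite (f ` range s - V)"
        using s V by (intro compact_preserving_sequence[OF Y f s(2)]) (auto simp: B_def)
      \<comment> \<open>All values along \<open>s\<close> avoid \<open>V\<close>, so the finiteness
        outside \<open>V\<close> bounds the whole range and the pigeonhole principle
        applies.\<close>
      moreover have "f ` range s - V = range (\<lambda>n. f (s n))"
        using s(1) unfolding B_def by auto
      ultimately obtain m where m: "infinite {n. f (s n) = f (s m)}"
        using pigeonhole_infinite[of UNIV "\<lambda>n. f (s n)"] by auto
      have "x \<in> X closure_of {p \<in> topspace X. f p = f (s m)}"
        unfolding in_closure_of
      proof (intro conjI x allI impI)
        fix T assume "x \<in> T \<and> openin X T"
        then obtain M where M: "\<And>n. n \<ge> M \<Longrightarrow> s n \<in> T"
          using s(2) unfolding limitin_sequentially by blast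
        obtain n where "n \<ge> M" "f (s n) = f (s m)"
          using m unfolding infinite_nat_iff_unbounded_le by blast
        then show "\<exists>y. y \<in> {p \<in> topspace X. f p = f (s m)} \<and> y \<in> T"
          using M s(1) unfolding B_def by blast
      qed
      then have "f (s m) \<in> K"
        using s(1)[of m] fXY unfolding K_def B_def by auto
      then show False
        using s(1)[of m] unfolding B_def by blast
    qed
    then obtain U where U: "openin X U" "x \<in> U" "U \<inter> B = {}"
      using x unfolding in_closure_of by blast
    then have "neighbourhood_in X x U"
      unfolding neighbourhood_in_def using openin_subset by blast
    moreover have "f ` U \<subseteq> N \<union> K"
      using U V(3) openin_subset[OF U(1)] unfolding B_def by blast
    moreover have "finite (K - N)"
      using Kfin V(3) by (meson Diff_mono finite_subset order_refl)
    ultimately show "\<exists>U. neighbourhood_in X x U \<and> f ` U \<subseteq> N \<union> K \<and> finite (K - N)"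
      by blast
  qed
qed

theorem corollary1:
  fixes X :: "'a topology" and Y :: "'b topology" and f :: "'a \<Rightarrow> 'b"
  assumes "Hausdorff_space Y" and "f \<in> topspace X \<rightarrow> topspace Y"
  shows "(finite_exception_condition X Y f \<longrightarrow> compact_preserving_map X Y f) \<and>
         (strong_Frechet_space X \<longrightarrow>
            (compact_preserving_map X Y f \<longleftrightarrow> finite_exception_condition X Y f))"
  using finite_exception_imp_compact_preserving[OF assms(2)]
    compact_preserving_imp_finite_exception[OF assms(1)] by metis

end
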